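(* For any $\varepsilon>0$ such that $K=1/\varepsilon$ is a positive integer, the assortment $(x,y)$ output by the algorithm described in the context satisfies $\pi(x,y)\ge(\mathbf{Gap}-4\varepsilon)\,\pi^*$, where $\pi^*$ is the optimal value of the base-model assortment optimization problem.
   Context: Base model: $\mathbf N=\{1,\dots,n\}$, $\mathbf M=\{1,\dots,m\}$, $\mathbf N_+=\mathbf N\cup\{0\}$, $\mathbf M_+=\mathbf M\cup\{0\}$, prices $p_i\ge0,q_j\ge0$, $p_0=q_0=0$, weights $u_{ij}\ge0$ on $\mathbf N_+\times\mathbf M_+$ with $u_{00}=1$. For $(x,y)\in\{0,1\}^n\times\{0,1\}^m$ with $x_0=y_0=1$: $\pi(x,y)=\frac{\sum_{i,j}u_{ij}x_iy_j(p_i+q_j)}{\sum_{i,j}u_{ij}x_iy_j}$; $\pi^*=\max\pi$. LP in nonnegative variables $x\in\mathbb R^n,y\in\mathbb R^m,z\in\mathbb R^{n\times m},w$: maximize $\sum_{i,j}u_{ij}(p_i+q_j)z_{ij}+\sum_iu_{i0}p_ix_i+\sum_ju_{0j}q_jy_j$ s.t. $w+\sum_{i,j}u_{ij}z_{ij}+\sum_iu_{i0}x_i+\sum_ju_{0j}y_j=1$, $z_{ij}\le x_i$, $z_{ij}\le y_j$, $z_{ij}\ge x_i+y_j-w$. Its optimal value is $r^*$. $\mathbf{Gap}$ is the infimum over all instances of (optimal assortment revenue)/(optimal LP value). Algorithm: solve the LP, obtaining $r^*$ and an optimal basic feasible solution $(x^{LP},y^{LP},z^{LP},w^{LP})$;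 let $\tilde x=x^{LP}/w^{LP}$, $\tilde y=y^{LP}/w^{LP}$. Let $b_k=1-k\varepsilon$, $k=0,\dots,K$. For $I=1,\dots,K$: $\mathbf N_{1,I}=\{i\in\mathbf N:\tilde x_i=1,\ p_i\in[b_Ir^*,b_{I-1}r^* )\}$, $\mathbf N_{2,I}=\{i\in\mathbf N:\tilde x_i=\tfrac12,\ p_i\in[b_Ir^*,b_{I-1}r^* )\}$, and $\mathbf M_{1,J},\mathbf M_{2,J}$ analogously with $\tilde y_j,q_j$; $\mathbf N_{\ge}=\{i\in\mathbf N:p_i\ge r^*\}$, $\mathbf M_{\ge}=\{j\in\mathbf M:q_j\ge r^*\}$. Compute $\pi(x,y)$ for all $(x,y)\in\{0,1\}^n\times\{0,1\}^m$ such that: (a) $x_i=1$ for $i\in\mathbf N_\ge$ and $y_j=1$ for $j\in\mathbf M_\ge$; (b) $x_i=x_k$ whenever $i,k$ lie in the same $\mathbf N_{1,I}$ or the same $\mathbf N_{2,I}$; (c) $y_j=y_l$ whenever $j,l$ lie in the same $\mathbf M_{1,J}$ or the same $\mathbf M_{2,J}$; (d) $x_i=0$ if $x^{LP}_i=0$ and $y_j=0$ if $y^{LP}_j=0$. Output one with the largest revenue. *)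

theory Defs
  imports Complex_Main
begin

section \<open>The base model\<close>

text \<open>
  The item sets are \<open>{1..n}\<close> and \<open>{1..m}\<close>; index \<open>0\<close> is the no-purchase option.
  Only the values of the prices on \<open>{0..n}\<close>, \<open>{0..m}\<close> and of the weights on
  \<open>{0..n} \<times> {0..m}\<close> are meaningful.
\<close>

record model =
  dimN :: nat
  dimM :: nat
  priceN :: "nat \<Rightarrow> real"
  priceM :: "nat \<Rightarrow> real"
  weight :: "nat \<Rightarrow> nat \<Rightarrow> real"

abbreviation itemsN :: "model \<Rightarrow> nat set" where "itemsN A \<equiv> {1..dimN A}"
abbreviation itemsM :: "model \<Rightarrow> nat set" where "itemsM A \<equiv> {1..dimM A}"

text \<open>
  Both item sets are nonempty.  This matters: the bounds \<open>x\<^sub>i \<le> w\<close> and \<open>y\<^sub>j \<le> w\<close> follow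
  from the constraints on \<open>z\<^sub>i\<^sub>j\<close> only if there is at least one \<open>j\<close>, respectively one \<open>i\<close>.
\<close>

definition valid_model :: "model \<Rightarrow> bool" where
  "valid_model A \<longleftrightarrow>
     dimN A \<ge> 1 \<and> dimM A \<ge> 1 \<and>
     priceN A 0 = 0 \<and> priceM A 0 = 0 \<and>
     (\<forall>i\<in>itemsN A. priceN A i \<ge> 0) \<and> (\<forall>j\<in>itemsM A. priceM A j \<ge> 0) \<and>
     (\<forall>i\<in>{0..dimN A}. \<forall>j\<in>{0..dimM A}. weight A i j \<ge> 0) \<and>
     weight A 0 0 = 1"

text \<open>
  A vector in \<open>{0,1}\<^sup>k\<close>, extended by \<open>1\<close> at index \<open>0\<close>, is a function that vanishes
  beyond \<open>k\<close>, so that there are only finitely many.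
\<close>

definition binary :: "nat \<Rightarrow> (nat \<Rightarrow> real) set" where
  "binary k = {x. x 0 = 1 \<and> (\<forall>i\<in>{1..k}. x i \<in> {0, 1}) \<and> (\<forall>i>k. x i = 0)}"

definition revenue :: "model \<Rightarrow> (nat \<Rightarrow> real) \<Rightarrow> (nat \<Rightarrow> real) \<Rightarrow> real" where
  "revenue A x y =
     (\<Sum>i=0..dimN A. \<Sum>j=0..dimM A. weight A i j * x i * y j * (priceN A i + priceM A j)) /
     (\<Sum>i=0..dimN A. \<Sum>j=0..dimM A. weight A i j * x i * y j)"

definition assortments :: "model \<Rightarrow> ((nat \<Rightarrow> real) \<times> (nat \<Rightarrow> real)) set" where
  "assortments A = binary (dimN A) \<times> binary (dimM A)"

definition opt_revenue :: "model \<Rightarrow> real" where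
  "opt_revenue A = Max ((\<lambda>(x, y). revenue A x y) ` assortments A)"


section \<open>The linear program\<close>

datatype lp_var = Xv nat | Yv nat | Zv nat nat | Wv

definition lp_vars :: "model \<Rightarrow> lp_var set" where
  "lp_vars A = Xv ` itemsN A \<union> Yv ` itemsM A \<union>
     (\<lambda>(i, j). Zv i j) ` (itemsN A \<times> itemsM A) \<union> {Wv}"

definition lp_objective :: "model \<Rightarrow> (lp_var \<Rightarrow> real) \<Rightarrow> real" where
  "lp_objective A s =
     (\<Sum>i\<in>itemsN A. \<Sum>j\<in>itemsM A. weight A i j * (priceN A i + priceM A j) * s (Zv i j)) +
     (\<Sum>i\<in>itemsN A. weight A i 0 * priceN A i * s (Xv i)) +
     (\<Sum>j\<in>itemsM A. weight A 0 j * priceM A j * s (Yv j))"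

definition lp_norm :: "model \<Rightarrow> (lp_var \<Rightarrow> real) \<Rightarrow> real" where
  "lp_norm A s =
     s Wv + (\<Sum>i\<in>itemsN A. \<Sum>j\<in>itemsM A. weight A i j * s (Zv i j)) +
     (\<Sum>i\<in>itemsN A. weight A i 0 * s (Xv i)) +
     (\<Sum>j\<in>itemsM A. weight A 0 j * s (Yv j))"

definition lp_feasible :: "model \<Rightarrow> (lp_var \<Rightarrow> real) \<Rightarrow> bool" where
  "lp_feasible A s \<longleftrightarrow>
     (\<forall>v\<in>lp_vars A. s v \<ge> 0) \<and>
     lp_norm A s = 1 \<and>
     (\<forall>i\<in>itemsN A. \<forall>j\<in>itemsM A.
        s (Zv i j) \<le> s (Xv i) \<and>
        s (Zv i j) \<le> s (Yv j) \<and>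
        s (Zv i j) \<ge> s (Xv i) + s (Yv j) - s Wv)"

definition lp_value :: "model \<Rightarrow> real" where
  "lp_value A = Sup (lp_objective A ` {s. lp_feasible A s})"

definition lp_optimal :: "model \<Rightarrow> (lp_var \<Rightarrow> real) \<Rightarrow> bool" where
  "lp_optimal A s \<longleftrightarrow>
     lp_feasible A s \<and> (\<forall>t. lp_feasible A t \<longrightarrow> lp_objective A t \<le> lp_objective A s)"

text \<open>
  The constraints as an indexed family, each in the form \<open>lp_form A c s = lp_rhs c\<close> (for
  \<open>NormC\<close>) or \<open>lp_form A c s \<ge> lp_rhs c\<close> (otherwise), with \<open>lp_form A c\<close> linear.
\<close>

datatype lp_con = NormC | ZleX nat nat | ZleY nat nat | ZgeXYW nat nat | NonNeg lp_var

definition lp_cons :: "model \<Rightarrow> lp_con set" where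
  "lp_cons A = {NormC} \<union> NonNeg ` lp_vars A \<union>
     (\<Union>i\<in>itemsN A. \<Union>j\<in>itemsM A. {ZleX i j, ZleY i j, ZgeXYW i j})"

fun lp_form :: "model \<Rightarrow> lp_con \<Rightarrow> (lp_var \<Rightarrow> real) \<Rightarrow> real" where
  "lp_form A NormC s = lp_norm A s"
| "lp_form A (ZleX i j) s = s (Xv i) - s (Zv i j)"
| "lp_form A (ZleY i j) s = s (Yv j) - s (Zv i j)"
| "lp_form A (ZgeXYW i j) s = s (Zv i j) - s (Xv i) - s (Yv j) + s Wv"
| "lp_form A (NonNeg v) s = s v"

definition lp_rhs :: "lp_con \<Rightarrow> real" where
  "lp_rhs c = (if c = NormC then 1 else 0)"

lemma lp_feasible_iff:
  "lp_feasible A s \<longleftrightarrow>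
     lp_form A NormC s = lp_rhs NormC \<and>
     (\<forall>c\<in>lp_cons A - {NormC}. lp_form A c s \<ge> lp_rhs c)"
proof -
  have "lp_cons A - {NormC} = NonNeg ` lp_vars A \<union>
      (\<Union>i\<in>itemsN A. \<Union>j\<in>itemsM A. {ZleX i j, ZleY i j, ZgeXYW i j})"
    by (auto simp: lp_cons_def)
  then show ?thesis
    by (auto simp: lp_feasible_def lp_rhs_def ball_Un algebra_simps)
qed

definition lp_coeff :: "model \<Rightarrow> lp_con \<Rightarrow> lp_var \<Rightarrow> real" where
  "lp_coeff A c v = lp_form A c (\<lambda>v'. if v' = v then 1 else 0)"

definition lp_active :: "model \<Rightarrow> (lp_var \<Rightarrow> real) \<Rightarrow> lp_con set" where
  "lp_active A s = {c \<in> lp_cons A. lp_form A c s = lp_rhs c}"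

definition lp_independent :: "model \<Rightarrow> lp_con set \<Rightarrow> bool" where
  "lp_independent A B \<longleftrightarrow>
     (\<forall>a. (\<forall>v\<in>lp_vars A. (\<Sum>c\<in>B. a c * lp_coeff A c v) = 0) \<longrightarrow> (\<forall>c\<in>B. a c = 0))"

text \<open>
  A basic feasible solution of an LP in \<open>d\<close> variables: a feasible point at which \<open>d\<close>
  constraints with linearly independent coefficient vectors are active.
\<close>

definition lp_basic_feasible :: "model \<Rightarrow> (lp_var \<Rightarrow> real) \<Rightarrow> bool" where
  "lp_basic_feasible A s \<longleftrightarrow>
     lp_feasible A s \<and>
     (\<exists>B \<subseteq> lp_active A s. card B = card (lp_vars A) \<and> lp_independent A B)"

text \<open>
  Instances with LP value \<open>0\<close> are left out: their ratio is \<open>0/0\<close>, which in HOL is \<open>0\<close> and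
  would make the infimum \<open>0\<close>.
\<close>

definition Gap :: real where
  "Gap = Inf {opt_revenue A / lp_value A | A. valid_model A \<and> lp_value A > 0}"


section \<open>The algorithm\<close>

definition breakpoint :: "real \<Rightarrow> nat \<Rightarrow> real" where
  "breakpoint \<epsilon> k = 1 - real k * \<epsilon>"

text \<open>
  For \<open>t = 1\<close> and \<open>t = 1/2\<close> these are the sets with first index \<open>1\<close> and \<open>2\<close>.
\<close>

definition classN :: "model \<Rightarrow> real \<Rightarrow> (lp_var \<Rightarrow> real) \<Rightarrow> real \<Rightarrow> nat \<Rightarrow> nat set" where
  "classN A \<epsilon> s t I = {i \<in> itemsN A. s (Xv i) / s Wv = t \<and>
     priceN A i \<in> {breakpoint \<epsilon> I * lp_value A ..< breakpoint \<epsilon> (I - 1) * lp_value A}}"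

definition classM :: "model \<Rightarrow> real \<Rightarrow> (lp_var \<Rightarrow> real) \<Rightarrow> real \<Rightarrow> nat \<Rightarrow> nat set" where
  "classM A \<epsilon> s t J = {j \<in> itemsM A. s (Yv j) / s Wv = t \<and>
     priceM A j \<in> {breakpoint \<epsilon> J * lp_value A ..< breakpoint \<epsilon> (J - 1) * lp_value A}}"

definition highN :: "model \<Rightarrow> nat set" where
  "highN A = {i \<in> itemsN A. priceN A i \<ge> lp_value A}"

definition highM :: "model \<Rightarrow> nat set" where
  "highM A = {j \<in> itemsM A. priceM A j \<ge> lp_value A}"

definition candidates ::
  "model \<Rightarrow> real \<Rightarrow> nat \<Rightarrow> (lp_var \<Rightarrow> real) \<Rightarrow> ((nat \<Rightarrow> real) \<times> (nat \<Rightarrow> real)) set" where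
  "candidates A \<epsilon> K s = {(x, y) \<in> assortments A.
     (\<forall>i\<in>highN A. x i = 1) \<and> (\<forall>j\<in>highM A. y j = 1) \<and>
     (\<forall>I\<in>{1..K}. \<forall>t\<in>{1, 1/2}. \<forall>i\<in>classN A \<epsilon> s t I. \<forall>k\<in>classN A \<epsilon> s t I. x i = x k) \<and>
     (\<forall>J\<in>{1..K}. \<forall>t\<in>{1, 1/2}. \<forall>j\<in>classM A \<epsilon> s t J. \<forall>l\<in>classM A \<epsilon> s t J. y j = y l) \<and>
     (\<forall>i\<in>itemsN A. s (Xv i) = 0 \<longrightarrow> x i = 0) \<and>
     (\<forall>j\<in>itemsM A. s (Yv j) = 0 \<longrightarrow> y j = 0)}"

text \<open>
  The algorithm is nondeterministic: it may use any optimal basic feasible solution and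
  return any candidate of largest revenue.
\<close>

definition algorithm_output ::
  "model \<Rightarrow> real \<Rightarrow> nat \<Rightarrow> (nat \<Rightarrow> real) \<Rightarrow> (nat \<Rightarrow> real) \<Rightarrow> bool" where
  "algorithm_output A \<epsilon> K x y \<longleftrightarrow>
     (\<exists>s. lp_optimal A s \<and> lp_basic_feasible A s \<and>
        (x, y) \<in> candidates A \<epsilon> K s \<and>
        (\<forall>(x', y') \<in> candidates A \<epsilon> K s. revenue A x' y' \<le> revenue A x y))"


section \<open>Basic facts\<close>

lemma finite_binary: "finite (binary k)"
proof -
  have "binary k \<subseteq> {f. \<forall>i. (i \<in> {0..k} \<longrightarrow> f i \<in> {0, 1}) \<and> (i \<notin> {0..k} \<longrightarrow> f i = 0)}"
  proof
    fix f assume f: "f \<in> binary k"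
    have "f i \<in> {0, 1}" if "i \<le> k" for i
      using f that by (cases "i = 0") (auto simp: binary_def)
    with f show "f \<in> {f. \<forall>i. (i \<in> {0..k} \<longrightarrow> f i \<in> {0, 1}) \<and> (i \<notin> {0..k} \<longrightarrow> f i = 0)}"
      by (auto simp: binary_def)
  qed
  moreover have "finite \<dots>"
    by (rule finite_set_of_finite_funs) auto
  ultimately show ?thesis by (rule finite_subset)
qed

lemma finite_assortments: "finite (assortments A)"
  by (simp add: assortments_def finite_binary)

lemma assortments_nonempty: "assortments A \<noteq> {}"
proof -
  have "(\<lambda>i. if i = 0 then 1 else 0) \<in> binary k" for k
    by (auto simp: binary_def)
  then show ?thesis by (auto simp: assortments_def)
qed

lemma lp_value_eq: "lp_optimal A s \<Longrightarrow> lp_value A = lp_objective A s"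
  unfolding lp_value_def lp_optimal_def by (rule cSup_eq_maximum) auto

lemma lp_feasible_Wv_pos:
  assumes "valid_model A" "lp_feasible A s"
  shows "s Wv > 0"
proof (rule ccontr)
  assume "\<not> s Wv > 0"
  with assms(2) have w: "s Wv = 0"
    by (auto simp: lp_feasible_def lp_vars_def)
  have nn: "s (Xv i) \<ge> 0" "s (Yv j) \<ge> 0" "s (Zv i j) \<ge> 0"
    and z: "s (Zv i j) \<le> s (Xv i)" "s (Zv i j) \<le> s (Yv j)" "s (Zv i j) \<ge> s (Xv i) + s (Yv j)"
    if "i \<in> itemsN A" "j \<in> itemsM A" for i j
    using assms(2) that w by (auto simp: lp_feasible_def lp_vars_def ball_Un)
  have d: "1 \<in> itemsN A" "1 \<in> itemsM A"
    using assms(1) by (auto simp: valid_model_def)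
  have "s (Xv i) = 0" if "i \<in> itemsN A" for i
    using nn[OF that d(2)] z[OF that d(2)] by linarith
  moreover have "s (Yv j) = 0" if "j \<in> itemsM A" for j
    using nn[OF d(1) that] z[OF d(1) that] by linarith
  moreover have "s (Zv i j) = 0" if "i \<in> itemsN A" "j \<in> itemsM A" for i j
    using nn[OF that] z[OF that] by linarith
  ultimately have "lp_norm A s = 0"
    by (simp add: lp_norm_def w)
  with assms(2) show False by (simp add: lp_feasible_def)
qed

text \<open>
  There is a candidate unless an item whose price is at least the LP value gets the
  value \<open>0\<close> in the LP solution, which makes the two requirements on it contradictory.
\<close>

lemma candidates_nonempty_iff:
  "candidates A \<epsilon> K s \<noteq> {} \<longleftrightarrow>
     (\<forall>i\<in>highN A. s (Xv i) \<noteq> 0) \<and> (\<forall>j\<in>highM A. s (Yv j) \<noteq> 0)"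
proof
  assume "candidates A \<epsilon> K s \<noteq> {}"
  then obtain x y where "(x, y) \<in> candidates A \<epsilon> K s" by auto
  then have "\<forall>i\<in>highN A. x i = 1" "\<forall>j\<in>highM A. y j = 1"
    "\<forall>i\<in>itemsN A. s (Xv i) = 0 \<longrightarrow> x i = 0" "\<forall>j\<in>itemsM A. s (Yv j) = 0 \<longrightarrow> y j = 0"
    unfolding candidates_def by blast+
  moreover have "highN A \<subseteq> itemsN A" "highM A \<subseteq> itemsM A"
    by (auto simp: highN_def highM_def)
  ultimately show "(\<forall>i\<in>highN A. s (Xv i) \<noteq> 0) \<and> (\<forall>j\<in>highM A. s (Yv j) \<noteq> 0)"
    by (metis subsetD zero_neq_one)
next
  assume *: "(\<forall>i\<in>highN A. s (Xv i) \<noteq> 0) \<and> (\<forall>j\<in>highM A. s (Yv j) \<noteq> 0)"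
  define x :: "nat \<Rightarrow> real" where
    "x = (\<lambda>i. if i = 0 \<or> i \<in> itemsN A \<and> s (Xv i) \<noteq> 0 then 1 else 0)"
  define y :: "nat \<Rightarrow> real" where
    "y = (\<lambda>j. if j = 0 \<or> j \<in> itemsM A \<and> s (Yv j) \<noteq> 0 then 1 else 0)"
  have "(x, y) \<in> assortments A"
    by (auto simp: assortments_def binary_def x_def y_def)
  moreover have X: "x i = 1" if "i \<in> classN A \<epsilon> s t I" "t \<in> {1, 1/2}" for i t I
    using that by (auto simp: x_def classN_def)
  have "\<forall>I\<in>{1..K}. \<forall>t\<in>{1, 1/2}. \<forall>i\<in>classN A \<epsilon> s t I. \<forall>k\<in>classN A \<epsilon> s t I. x i = x k"
    by (intro ballI) (simp only: X)
  moreover have Y: "y j = 1" if "j \<in> classM A \<epsilon> s t J" "t \<in> {1, 1/2}" for j t J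
    using that by (auto simp: y_def classM_def)
  have "\<forall>J\<in>{1..K}. \<forall>t\<in>{1, 1/2}. \<forall>j\<in>classM A \<epsilon> s t J. \<forall>l\<in>classM A \<epsilon> s t J. y j = y l"
    by (intro ballI) (simp only: Y)
  moreover have "\<forall>i\<in>highN A. x i = 1" "\<forall>j\<in>highM A. y j = 1"
    using * by (auto simp: x_def y_def highN_def highM_def)
  moreover have "\<forall>i\<in>itemsN A. s (Xv i) = 0 \<longrightarrow> x i = 0" "\<forall>j\<in>itemsM A. s (Yv j) = 0 \<longrightarrow> y j = 0"
    by (auto simp: x_def y_def)
  ultimately have "(x, y) \<in> candidates A \<epsilon> K s"
    unfolding candidates_def by blast
  then show "candidates A \<epsilon> K s \<noteq> {}" by auto
qed

end

theory Submission
  imports Defs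
begin

text \<open>
  Round the prices down to multiples of \<open>\<epsilon> r\<^sup>*\<close>, drop the items that the LP solution does not use,
  and merge all items with the same LP value and the same rounded price into one item whose
  weights are the sums of the merged weights.  Averaging the variables \<open>z\<^sub>i\<^sub>j\<close> over the merged
  pairs turns the LP solution into a feasible solution for the merged instance that loses at most
  \<open>2 \<epsilon> r\<^sup>*\<close>, so the merged instance has an assortment of revenue at least
  \<open>Gap (1 - 2 \<epsilon>) r\<^sup>*\<close>.  Pulled back to the original items it is constant on the classes of the
  algorithm, and its revenue does not drop.  Adding the items of price at least \<open>r\<^sup>*\<close> does not
  decrease the revenue either, because no assortment earns more than \<open>r\<^sup>*\<close>.
\<close>

section \<open>Sums over pairs of indices\<close>

abbreviation index_pairs :: "model \<Rightarrow> (nat \<times> nat) set" where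
  "index_pairs A \<equiv> {0..dimN A} \<times> {0..dimM A}"

text \<open>
  With \<open>z\<^sub>i\<^sub>0 = x\<^sub>i\<close>, \<open>z\<^sub>0\<^sub>j = y\<^sub>j\<close> and \<open>z\<^sub>0\<^sub>0 = w\<close>, the norm and the objective of the LP are
  single sums over all pairs of indices.
\<close>

definition lp_pair :: "(lp_var \<Rightarrow> real) \<Rightarrow> nat \<Rightarrow> nat \<Rightarrow> real" where
  "lp_pair s i j =
     (if i = 0 then if j = 0 then s Wv else s (Yv j) else if j = 0 then s (Xv i) else s (Zv i j))"

lemma sum_index_pairs_split:
  fixes f :: "nat \<Rightarrow> nat \<Rightarrow> real"
  shows "(\<Sum>(i, j)\<in>index_pairs A. f i j) =
    f 0 0 + (\<Sum>i\<in>itemsN A. \<Sum>j\<in>itemsM A. f i j) + (\<Sum>i\<in>itemsN A. f i 0) + (\<Sum>j\<in>itemsM A. f 0 j)"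
  by (simp add: sum.cartesian_product [symmetric] sum.atLeast_Suc_atMost sum.distrib)

lemma lp_norm_eq_sum_pairs:
  assumes "valid_model A"
  shows "lp_norm A s = (\<Sum>(i, j)\<in>index_pairs A. weight A i j * lp_pair s i j)"
  using assms unfolding sum_index_pairs_split lp_norm_def
  by (simp add: lp_pair_def valid_model_def)

lemma lp_objective_eq_sum_pairs:
  assumes "valid_model A"
  shows "lp_objective A s =
    (\<Sum>(i, j)\<in>index_pairs A. weight A i j * lp_pair s i j * (priceN A i + priceM A j))"
  using assms unfolding sum_index_pairs_split lp_objective_def
  by (simp add: lp_pair_def valid_model_def mult_ac)

lemma valid_model_weight_nonneg:
  "valid_model A \<Longrightarrow> i \<le> dimN A \<Longrightarrow> j \<le> dimM A \<Longrightarrow> 0 \<le> weight A i j"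
  by (simp add: valid_model_def)

lemma valid_model_price_nonneg:
  assumes "valid_model A"
  shows "i \<le> dimN A \<Longrightarrow> 0 \<le> priceN A i" "j \<le> dimM A \<Longrightarrow> 0 \<le> priceM A j"
  using assms by (cases "i = 0"; cases "j = 0"; simp add: valid_model_def)+

lemma lp_pair_nonneg:
  assumes "lp_feasible A s" "i \<le> dimN A" "j \<le> dimM A"
  shows "0 \<le> lp_pair s i j"
  using assms by (auto simp: lp_pair_def lp_feasible_def lp_vars_def ball_Un)

text \<open>By the normalization constraint the objective is an average of the price sums with total
  weight 1, so the sum of all prices bounds it. The bound is what makes the \<open>Sup\<close> in
  \<open>lp_value\<close> an actual least upper bound.\<close>

lemma lp_objective_bdd_above:
  assumes A: "valid_model A"
  shows "bdd_above (lp_objective A ` {s. lp_feasible A s})"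
proof (intro bdd_aboveI2)
  define P where "P = (\<Sum>i=0..dimN A. priceN A i) + (\<Sum>j=0..dimM A. priceM A j)"
  fix s assume "s \<in> {s. lp_feasible A s}"
  then have s: "lp_feasible A s" by simp
  have P: "priceN A i + priceM A j \<le> P" if "i \<le> dimN A" "j \<le> dimM A" for i j
    unfolding P_def using that valid_model_price_nonneg[OF A]
    by (intro add_mono member_le_sum) auto
  have "lp_objective A s \<le> (\<Sum>(i, j)\<in>index_pairs A. weight A i j * lp_pair s i j * P)"
    unfolding lp_objective_eq_sum_pairs[OF A]
    using P valid_model_weight_nonneg[OF A] lp_pair_nonneg[OF s]
    by (intro sum_mono) (auto intro!: mult_left_mono mult_nonneg_nonneg)
  also have "\<dots> = lp_norm A s * P"
    unfolding lp_norm_eq_sum_pairs[OF A] by (simp add: sum_distrib_right case_prod_beta)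
  also have "\<dots> = P" using s by (simp add: lp_feasible_def)
  finally show "lp_objective A s \<le> P" .
qed

lemma lp_objective_le_value:
  "valid_model A \<Longrightarrow> lp_feasible A s \<Longrightarrow> lp_objective A s \<le> lp_value A"
  unfolding lp_value_def by (rule cSup_upper) (auto intro: lp_objective_bdd_above)

section \<open>Revenues of assortments\<close>

definition demand :: "model \<Rightarrow> (nat \<Rightarrow> real) \<Rightarrow> (nat \<Rightarrow> real) \<Rightarrow> real" where
  "demand A x y = (\<Sum>(i, j)\<in>index_pairs A. weight A i j * x i * y j)"

definition earnings :: "model \<Rightarrow> (nat \<Rightarrow> real) \<Rightarrow> (nat \<Rightarrow> real) \<Rightarrow> real" where
  "earnings A x y =
     (\<Sum>(i, j)\<in>index_pairs A. weight A i j * x i * y j * (priceN A i + priceM A j))"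

lemma revenue_eq: "revenue A x y = earnings A x y / demand A x y"
  by (simp add: revenue_def earnings_def demand_def sum.cartesian_product)

lemma binary_bounds:
  assumes "x \<in> binary k"
  shows "0 \<le> x i" "x i \<le> 1"
proof -
  have "x i = 0 \<or> x i = 1"
    using assms unfolding binary_def by (cases "i = 0"; cases "i \<le> k") auto
  then show "0 \<le> x i" "x i \<le> 1" by auto
qed

text \<open>The no-purchase pair alone contributes 1, so dividing by the demand is always
  safe.\<close>

lemma demand_ge_1:
  assumes A: "valid_model A" and xy: "(x, y) \<in> assortments A"
  shows "1 \<le> demand A x y"
proof -
  have x: "x \<in> binary (dimN A)" and y: "y \<in> binary (dimM A)"
    using xy by (auto simp: assortments_def)
  have "(\<lambda>(i, j). weight A i j * x i * y j) (0, 0) \<le> demand A x y"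
    unfolding demand_def
    using valid_model_weight_nonneg[OF A] binary_bounds[OF x] binary_bounds[OF y]
    by (intro member_le_sum) auto
  then show ?thesis
    using A x y by (simp add: binary_def valid_model_def)
qed

lemma revenue_nonneg:
  assumes A: "valid_model A" and xy: "(x, y) \<in> assortments A"
  shows "0 \<le> revenue A x y"
proof -
  have x: "x \<in> binary (dimN A)" and y: "y \<in> binary (dimM A)"
    using xy by (auto simp: assortments_def)
  have "0 \<le> earnings A x y"
    unfolding earnings_def
    using valid_model_weight_nonneg[OF A] valid_model_price_nonneg[OF A]
      binary_bounds[OF x] binary_bounds[OF y]
    by (intro sum_nonneg) auto
  then show ?thesis
    using demand_ge_1[OF assms] by (simp add: revenue_eq)
qed

lemma opt_revenue_attained:
  obtains x y where "(x, y) \<in> assortments A" "opt_revenue A = revenue A x y"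
proof -
  have "opt_revenue A \<in> (\<lambda>(x, y). revenue A x y) ` assortments A"
    unfolding opt_revenue_def
    by (intro Max_in) (simp_all add: finite_assortments assortments_nonempty)
  then show ?thesis using that by auto
qed

text \<open>The LP is a relaxation: dividing \<open>x\<close>, \<open>y\<close>, their products and
  1 by the demand gives a feasible point whose objective is the revenue.\<close>

lemma revenue_le_lp_value:
  assumes A: "valid_model A" and xy: "(x, y) \<in> assortments A"
  shows "revenue A x y \<le> lp_value A"
proof -
  have x: "x \<in> binary (dimN A)" and y: "y \<in> binary (dimM A)"
    using xy by (auto simp: assortments_def)
  define D where "D = demand A x y"
  have D: "D > 0" using demand_ge_1[OF assms] by (simp add: D_def)
  define s where "s = (\<lambda>v. case v of Xv i \<Rightarrow> x i / D | Yv j \<Rightarrow> y j / D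
      | Zv i j \<Rightarrow> x i * y j / D | Wv \<Rightarrow> 1 / D)"
  have pair: "lp_pair s i j = x i * y j / D" for i j
    using x y by (simp add: lp_pair_def s_def binary_def)
  have norm: "lp_norm A s = 1"
    unfolding lp_norm_eq_sum_pairs[OF A] pair using D
    by (simp add: D_def demand_def sum_divide_distrib [symmetric] case_prod_beta mult.assoc)
  have b: "0 \<le> x i" "x i \<le> 1" "0 \<le> y j" "y j \<le> 1" for i j
    using binary_bounds[OF x] binary_bounds[OF y] by auto
  have "x i * y j / D \<ge> x i / D + y j / D - 1 / D" for i j
  proof -
    \<comment> \<open>Expanding this product gives the lower bound that the LP imposes on
      \<open>Zv i j\<close>.\<close>
    have "0 \<le> (1 - x i) * (1 - y j)" using b by simp
    then have "x i + y j - 1 \<le> x i * y j" by (simp add: algebra_simps)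
    then have "(x i + y j - 1) / D \<le> x i * y j / D" using D by (simp add: divide_right_mono)
    then show ?thesis by (simp add: add_divide_distrib diff_divide_distrib)
  qed
  moreover have "x i * y j / D \<le> x i / D" "x i * y j / D \<le> y j / D" for i j
    using b D by (auto intro!: divide_right_mono simp: mult_left_le mult_left_le_one_le)
  moreover have "s v \<ge> 0" for v
    using b D by (simp add: s_def split: lp_var.split)
  ultimately have "lp_feasible A s"
    using norm by (simp add: lp_feasible_def s_def)
  moreover have "lp_objective A s = revenue A x y"
    unfolding lp_objective_eq_sum_pairs[OF A] pair revenue_eq earnings_def D_def
    by (simp add: sum_divide_distrib case_prod_beta mult_ac)
  ultimately show ?thesis
    using lp_objective_le_value[OF A] by fastforce
qed

lemma opt_revenue_nonneg: "valid_model A \<Longrightarrow> 0 \<le> opt_revenue A"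
  by (metis opt_revenue_attained revenue_nonneg)

lemma opt_revenue_le_lp_value: "valid_model A \<Longrightarrow> opt_revenue A \<le> lp_value A"
  by (metis opt_revenue_attained revenue_le_lp_value)

text \<open>Let \<open>R\<close> be the revenue of \<open>(x, y)\<close>. Earnings minus
  \<open>R\<close> times demand vanish at \<open>(x, y)\<close>. A changed pair has price sum at
  least \<open>r\<close>, hence at least \<open>R\<close>, and its product can only grow, so this
  excess is nonnegative at \<open>(x', y')\<close>.\<close>

lemma revenue_add_expensive_items:
  assumes A: "valid_model A"
    and xy: "(x, y) \<in> assortments A" and xy': "(x', y') \<in> assortments A"
    and r: "revenue A x y \<le> r"
    and x': "\<And>i. i \<le> dimN A \<Longrightarrow> x' i = x i \<or> x' i = 1 \<and> r \<le> priceN A i"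
    and y': "\<And>j. j \<le> dimM A \<Longrightarrow> y' j = y j \<or> y' j = 1 \<and> r \<le> priceM A j"
  shows "revenue A x y \<le> revenue A x' y'"
proof -
  define R where "R = revenue A x y"
  have D: "demand A x y > 0" "demand A x' y' > 0"
    using demand_ge_1[OF A xy] demand_ge_1[OF A xy'] by auto
  have b: "0 \<le> x i" "x i \<le> 1" "0 \<le> y j" "y j \<le> 1" "0 \<le> x' i" "x' i \<le> 1" "0 \<le> y' j" "y' j \<le> 1" for i j
    using xy xy' binary_bounds unfolding assortments_def by (blast+)
  have excess: "earnings A a b - R * demand A a b =
      (\<Sum>(i, j)\<in>index_pairs A. weight A i j * (a i * b j * (priceN A i + priceM A j - R)))" for a b
    by (simp add: earnings_def demand_def sum_distrib_left case_prod_beta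
        sum_subtractf [symmetric] algebra_simps)
  have mono: "x i * y j * (priceN A i + priceM A j - R) \<le> x' i * y' j * (priceN A i + priceM A j - R)"
    if ij: "i \<le> dimN A" "j \<le> dimM A" for i j
  proof (cases "x' i = x i \<and> y' j = y j")
    case False
    then have "R \<le> priceN A i + priceM A j"
      using x'[OF ij(1)] y'[OF ij(2)] r valid_model_price_nonneg(1)[OF A ij(1)]
        valid_model_price_nonneg(2)[OF A ij(2)] by (auto simp: R_def)
    moreover have "x i * y j \<le> x' i * y' j"
      using x'[OF ij(1)] y'[OF ij(2)] b by (auto intro!: mult_mono)
    ultimately show ?thesis by (simp add: mult_right_mono)
  qed simp
  have "earnings A x y - R * demand A x y = 0"
    using D by (simp add: R_def revenue_eq)
  moreover have "earnings A x y - R * demand A x y \<le> earnings A x' y' - R * demand A x' y'"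
    unfolding excess using valid_model_weight_nonneg[OF A] mono
    by (intro sum_mono) (auto intro!: mult_left_mono)
  ultimately have "R * demand A x' y' \<le> earnings A x' y'" by simp
  then show ?thesis
    using D by (simp add: R_def [symmetric] revenue_eq[of A x'] pos_le_divide_eq)
qed

section \<open>The gap as a bound for single instances\<close>

lemma Gap_le: "valid_model A \<Longrightarrow> lp_value A > 0 \<Longrightarrow> Gap \<le> opt_revenue A / lp_value A"
  unfolding Gap_def
  by (rule cInf_lower) (auto intro!: bdd_belowI[of _ 0] simp: opt_revenue_nonneg)

text \<open>The model \<open>A\<close> witnesses that the set under the infimum is nonempty.\<close>

lemma Gap_nonneg: "valid_model A \<Longrightarrow> lp_value A > 0 \<Longrightarrow> 0 \<le> Gap"
  unfolding Gap_def by (rule cInf_greatest) (auto simp: opt_revenue_nonneg)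

section \<open>Merging items\<close>

text \<open>
  The item \<open>i\<close> of the merged instance stands for all items \<open>k \<in> S\<close> with \<open>g k = i\<close>; items outside
  the range of \<open>g\<close> get weight \<open>0\<close>, so that the dimensions need not change.
\<close>

locale merging =
  fixes A :: model and S T :: "nat set" and g h :: "nat \<Rightarrow> nat" and p q :: "nat \<Rightarrow> real"
  assumes A: "valid_model A"
    and S: "S \<subseteq> {0..dimN A}" "0 \<in> S" and T: "T \<subseteq> {0..dimM A}" "0 \<in> T"
    and g: "\<And>i. i \<in> S \<Longrightarrow> g i \<le> dimN A" "\<And>i. i \<in> S \<Longrightarrow> g i = 0 \<longleftrightarrow> i = 0"
    and h: "\<And>j. j \<in> T \<Longrightarrow> h j \<le> dimM A" "\<And>j. j \<in> T \<Longrightarrow> h j = 0 \<longleftrightarrow> j = 0"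
    and p: "p 0 = 0" "\<And>i. i \<in> itemsN A \<Longrightarrow> 0 \<le> p i" "\<And>i. i \<in> S \<Longrightarrow> p (g i) \<le> priceN A i"
    and q: "q 0 = 0" "\<And>j. j \<in> itemsM A \<Longrightarrow> 0 \<le> q j" "\<And>j. j \<in> T \<Longrightarrow> q (h j) \<le> priceM A j"
begin

text \<open>The condition is one equation between pairs, the shape in which \<open>sum.group\<close>
  partitions a sum.\<close>

definition fibre :: "nat \<Rightarrow> nat \<Rightarrow> (nat \<times> nat) set" where
  "fibre i j = {e \<in> S \<times> T. (g (fst e), h (snd e)) = (i, j)}"

definition merged :: model where
  "merged = A\<lparr>priceN := p, priceM := q, weight := \<lambda>i j. \<Sum>(k, l)\<in>fibre i j. weight A k l\<rparr>"

lemma merged_simps [simp]: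
  "dimN merged = dimN A" "dimM merged = dimM A" "priceN merged = p" "priceM merged = q"
  by (simp_all add: merged_def)

lemma weight_merged: "weight merged i j = (\<Sum>(k, l)\<in>fibre i j. weight A k l)"
  by (simp add: merged_def)

lemma finite_S: "finite S" and finite_T: "finite T"
  using S T by (auto intro: finite_subset)

lemma finite_fibre: "finite (fibre i j)"
  unfolding fibre_def using finite_S finite_T by simp

text \<open>The fibres partition \<open>S \<times> T\<close>: since \<open>g\<close> and
  \<open>h\<close> map into the index range, each pair is counted exactly once.\<close>

lemma sum_fibres:
  fixes f :: "nat \<Rightarrow> nat \<Rightarrow> real"
  shows "(\<Sum>(i, j)\<in>index_pairs A. \<Sum>(k, l)\<in>fibre i j. f k l) = (\<Sum>(k, l)\<in>S \<times> T. f k l)"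
proof -
  have "(\<Sum>e\<in>index_pairs A. \<Sum>d\<in>{d \<in> S \<times> T. (g (fst d), h (snd d)) = e}. f (fst d) (snd d)) =
      (\<Sum>d\<in>S \<times> T. f (fst d) (snd d))"
    using finite_S finite_T g h by (intro sum.group) auto
  then show ?thesis by (simp only: fibre_def case_prod_unfold prod.collapse)
qed

lemma weight_nonneg: "(k, l) \<in> S \<times> T \<Longrightarrow> 0 \<le> weight A k l"
  using valid_model_weight_nonneg[OF A] S T by (meson SigmaE2 atLeastAtMost_iff subsetD)

lemma weight_merged_nonneg: "0 \<le> weight merged i j"
  unfolding weight_merged using weight_nonneg by (auto intro!: sum_nonneg simp: fibre_def)

lemma valid_merged: "valid_model merged"
proof -
  \<comment> \<open>As \<open>g\<close> and \<open>h\<close> vanish only at 0, nothing is merged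
    into the no-purchase pair and its weight remains 1.\<close>
  have "fibre 0 0 = {(0, 0)}"
    using S T g(2) h(2) by (auto simp: fibre_def)
  then have "weight merged 0 0 = 1"
    using A by (simp add: weight_merged valid_model_def)
  then show ?thesis
    using A p q weight_merged_nonneg by (auto simp: valid_model_def)
qed

section \<open>Pulling assortments back to the original items\<close>

definition pullN :: "(nat \<Rightarrow> real) \<Rightarrow> nat \<Rightarrow> real" where
  "pullN x i = (if i \<in> S then x (g i) else 0)"

definition pullM :: "(nat \<Rightarrow> real) \<Rightarrow> nat \<Rightarrow> real" where
  "pullM y j = (if j \<in> T then y (h j) else 0)"

lemma pull_assortment:
  assumes "(x, y) \<in> assortments merged"
  shows "(pullN x, pullM y) \<in> assortments A"
proof -
  have x: "x 0 = 1" "\<And>i. i \<in> itemsN A \<Longrightarrow> x i \<in> {0, 1}"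
    and y: "y 0 = 1" "\<And>j. j \<in> itemsM A \<Longrightarrow> y j \<in> {0, 1}"
    using assms by (auto simp: assortments_def binary_def)
  have "x (g i) \<in> {0, 1}" if "i \<in> S" for i
    using x g(1)[OF that] by (cases "g i = 0") auto
  moreover have "y (h j) \<in> {0, 1}" if "j \<in> T" for j
    using y h(1)[OF that] by (cases "h j = 0") auto
  moreover have "i \<notin> S" if "i > dimN A" for i using S that by auto
  moreover have "j \<notin> T" if "j > dimM A" for j using T that by auto
  ultimately show ?thesis
    using x(1) y(1) g(2)[OF S(2)] h(2)[OF T(2)] S(2) T(2)
    by (auto simp: assortments_def binary_def pullN_def pullM_def)
qed

lemma sum_supported:
  fixes f :: "nat \<Rightarrow> nat \<Rightarrow> real"
  assumes "\<And>i j. i \<le> dimN A \<Longrightarrow> j \<le> dimM A \<Longrightarrow> i \<notin> S \<or> j \<notin> T \<Longrightarrow> f i j = 0"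
  shows "(\<Sum>(i, j)\<in>index_pairs A. f i j) = (\<Sum>(i, j)\<in>S \<times> T. f i j)"
proof (rule sum.mono_neutral_right)
  show "\<forall>e\<in>index_pairs A - S \<times> T. (case e of (i, j) \<Rightarrow> f i j) = 0"
    using assms by fastforce
qed (use S T in auto)

text \<open>Grouping by fibres shows that both assortments have the same demand, while every
  original price is at least the merged price that replaces it.\<close>

lemma revenue_merged_le:
  assumes xy: "(x, y) \<in> assortments merged"
  shows "revenue merged x y \<le> revenue A (pullN x) (pullM y)"
proof -
  have b: "0 \<le> x i" "0 \<le> y i" for i
    using xy binary_bounds unfolding assortments_def by blast+
  have "demand merged x y =
      (\<Sum>(i, j)\<in>index_pairs A. \<Sum>(k, l)\<in>fibre i j. weight A k l * x (g k) * y (h l))"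
    by (auto simp: demand_def weight_merged sum_distrib_right fibre_def intro!: sum.cong)
  also have "\<dots> = (\<Sum>(k, l)\<in>S \<times> T. weight A k l * x (g k) * y (h l))"
    by (rule sum_fibres)
  also have "\<dots> = (\<Sum>(k, l)\<in>S \<times> T. weight A k l * pullN x k * pullM y l)"
    by (auto simp: pullN_def pullM_def intro!: sum.cong)
  also have "\<dots> = demand A (pullN x) (pullM y)"
    unfolding demand_def by (intro sum_supported [symmetric]) (auto simp: pullN_def pullM_def)
  finally have D: "demand merged x y = demand A (pullN x) (pullM y)" .
  have "earnings merged x y = (\<Sum>(i, j)\<in>index_pairs A. \<Sum>(k, l)\<in>fibre i j.
      weight A k l * x (g k) * y (h l) * (p (g k) + q (h l)))"
    by (auto simp: earnings_def weight_merged sum_distrib_right fibre_def intro!: sum.cong)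
  also have "\<dots> = (\<Sum>(k, l)\<in>S \<times> T. weight A k l * x (g k) * y (h l) * (p (g k) + q (h l)))"
    by (rule sum_fibres)
  also have "\<dots> \<le> (\<Sum>(k, l)\<in>S \<times> T. weight A k l * pullN x k * pullM y l * (priceN A k + priceM A l))"
    using p(3) q(3) weight_nonneg b
    by (intro sum_mono) (auto simp: pullN_def pullM_def intro!: mult_left_mono add_mono mult_nonneg_nonneg)
  also have "\<dots> = earnings A (pullN x) (pullM y)"
    unfolding earnings_def by (intro sum_supported [symmetric]) (auto simp: pullN_def pullM_def)
  finally have "earnings merged x y \<le> earnings A (pullN x) (pullM y)" .
  then show ?thesis
    unfolding revenue_eq D using demand_ge_1[OF A pull_assortment[OF xy]]
    by (intro divide_right_mono) auto
qed

text \<open>The solution \<open>s\<close> vanishes off the kept items and is constant along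
  \<open>g\<close> and \<open>h\<close>, so averages over fibres stay feasible. The products of
  weights and LP values sum to 1, so lowering each of the two prices by at most
  \<open>\<delta>\<close> costs at most \<open>2 * \<delta>\<close>.\<close>

lemma lp_value_merged_ge:
  assumes s: "lp_feasible A s"
    and sS: "\<And>i. i \<in> itemsN A - S \<Longrightarrow> s (Xv i) = 0"
    and sT: "\<And>j. j \<in> itemsM A - T \<Longrightarrow> s (Yv j) = 0"
    and sg: "\<And>i. i \<in> S - {0} \<Longrightarrow> s (Xv (g i)) = s (Xv i)"
    and sh: "\<And>j. j \<in> T - {0} \<Longrightarrow> s (Yv (h j)) = s (Yv j)"
    and pd: "\<And>i. i \<in> S \<Longrightarrow> priceN A i - \<delta> \<le> p (g i)"
    and qd: "\<And>j. j \<in> T \<Longrightarrow> priceM A j - \<delta> \<le> q (h j)"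
  shows "lp_objective A s - 2 * \<delta> \<le> lp_value merged"
proof -
  define u where "u = weight merged"
  have u0: "0 \<le> u i j" for i j by (simp add: u_def weight_merged_nonneg)
  define Z where "Z i j = (\<Sum>(k, l)\<in>fibre i j. weight A k l * lp_pair s k l)" for i j
  \<comment> \<open>Only the \<open>Zv\<close> variables change. Where the merged weight is 0 there
    is no average; the old value is kept because it still satisfies the constraints.\<close>
  define s' where "s' = (\<lambda>v. case v of Zv i j \<Rightarrow> (if u i j = 0 then s v else Z i j / u i j) | _ \<Rightarrow> s v)"
  have s'_simps: "s' (Xv i) = s (Xv i)" "s' (Yv j) = s (Yv j)" "s' Wv = s Wv"
    "s' (Zv i j) = (if u i j = 0 then s (Zv i j) else Z i j / u i j)" for i j
    by (simp_all add: s'_def)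
  have s0: "0 \<le> s (Xv i)" "0 \<le> s (Yv j)" "0 \<le> s (Zv i j)" "0 \<le> s Wv"
      "s (Zv i j) \<le> s (Xv i)" "s (Zv i j) \<le> s (Yv j)" "s (Xv i) + s (Yv j) - s Wv \<le> s (Zv i j)"
    if "i \<in> itemsN A" "j \<in> itemsM A" for i j
    using s that by (auto simp: lp_feasible_def lp_vars_def ball_Un)
  have items: "1 \<in> itemsN A" "1 \<in> itemsM A"
    using A by (auto simp: valid_model_def)
  \<comment> \<open>A weighted average of the \<open>z\<^sub>k\<^sub>l\<close> over a fibre satisfies the constraints because
    \<open>x\<^sub>k\<close> and \<open>y\<^sub>l\<close> are constant on it.\<close>
  have avg: "c * u i j \<le> Z i j"
    if "\<And>k l. (k, l) \<in> fibre i j \<Longrightarrow> c \<le> lp_pair s k l" for c i j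
    unfolding u_def weight_merged Z_def sum_distrib_left
    using that weight_nonneg
    by (intro sum_mono) (auto simp: fibre_def mult.commute[of c] intro!: mult_left_mono)
  have avg': "Z i j \<le> c * u i j"
    if "\<And>k l. (k, l) \<in> fibre i j \<Longrightarrow> lp_pair s k l \<le> c" for c i j
    unfolding u_def weight_merged Z_def sum_distrib_left
    using that weight_nonneg
    by (intro sum_mono) (auto simp: fibre_def mult.commute[of c] intro!: mult_left_mono)
  \<comment> \<open>Fibres over nonzero indices avoid 0, so \<open>sg\<close> and \<open>sh\<close>
    carry the LP values of \<open>k\<close> and \<open>l\<close> over to \<open>i\<close> and
    \<open>j\<close>.\<close>
  have fib: "k \<in> itemsN A \<and> l \<in> itemsM A \<and> lp_pair s k l = s (Zv k l) \<and>
      s (Xv k) = s (Xv i) \<and> s (Yv l) = s (Yv j)"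
    if "(k, l) \<in> fibre i j" "i \<in> itemsN A" "j \<in> itemsM A" for k l i j
  proof -
    have kl: "k \<in> S" "l \<in> T" "g k = i" "h l = j" using that by (auto simp: fibre_def)
    with that g(2) h(2) have "k \<noteq> 0" "l \<noteq> 0" by fastforce+
    then show ?thesis
      using kl S T sg[of k] sh[of l] by (auto simp: lp_pair_def)
  qed
  have constr: "0 \<le> s' (Zv i j) \<and> s' (Zv i j) \<le> s (Xv i) \<and> s' (Zv i j) \<le> s (Yv j) \<and>
      s (Xv i) + s (Yv j) - s Wv \<le> s' (Zv i j)"
    if ij: "i \<in> itemsN A" "j \<in> itemsM A" for i j
  proof (cases "u i j = 0")
    case True
    then show ?thesis using s0[OF ij] by (simp add: s'_simps)
  next
    case False
    have "0 * u i j \<le> Z i j"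
      using fib[OF _ ij] s0 by (intro avg) auto
    moreover have "(s (Xv i) + s (Yv j) - s Wv) * u i j \<le> Z i j"
      using fib[OF _ ij] s0 by (intro avg) metis
    moreover have "Z i j \<le> s (Xv i) * u i j"
      using fib[OF _ ij] s0 by (intro avg') metis
    moreover have "Z i j \<le> s (Yv j) * u i j"
      using fib[OF _ ij] s0 by (intro avg') metis
    moreover have "u i j > 0" using False u0[of i j] by simp
    ultimately show ?thesis by (simp add: s'_simps pos_le_divide_eq pos_divide_le_eq)
  qed
  \<comment> \<open>This identity turns the norm and the objective of \<open>s'\<close> into sums
    over fibres of terms of \<open>s\<close>.\<close>
  have pair: "u i j * lp_pair s' i j = Z i j" if ij: "i \<le> dimN A" "j \<le> dimM A" for i j
  proof (cases "i = 0 \<or> j = 0")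
    case True
    \<comment> \<open>With an index 0, \<open>lp_pair\<close> is \<open>s Wv\<close> or a single
      \<open>Xv\<close> or \<open>Yv\<close> value, which is constant on the fibre.\<close>
    have "lp_pair s k l = lp_pair s i j" if "(k, l) \<in> fibre i j" for k l
    proof -
      have kl: "k \<in> S" "l \<in> T" "g k = i" "h l = j" using that by (auto simp: fibre_def)
      have "k = 0 \<longleftrightarrow> i = 0" "l = 0 \<longleftrightarrow> j = 0" using g(2) h(2) kl by auto
      then show ?thesis
        using True kl sg[of k] sh[of l] by (auto simp: lp_pair_def)
    qed
    then have "Z i j = (\<Sum>(k, l)\<in>fibre i j. weight A k l * lp_pair s i j)"
      unfolding Z_def by (intro sum.cong) auto
    also have "\<dots> = u i j * lp_pair s i j"
      by (simp add: u_def weight_merged sum_distrib_right case_prod_beta)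
    finally show ?thesis using True by (auto simp: lp_pair_def s'_simps)
  next
    case False
    \<comment> \<open>A vanishing sum of nonnegative weights has only zero terms, so the arbitrary
      value of \<open>s'\<close> there does no harm.\<close>
    have "Z i j = 0" if u: "u i j = 0"
    proof -
      have "\<forall>e\<in>fibre i j. (case e of (k, l) \<Rightarrow> weight A k l) = 0"
        using u finite_fibre weight_nonneg unfolding u_def weight_merged
        by (subst (asm) sum_nonneg_eq_0_iff) (auto simp: fibre_def)
      then show ?thesis unfolding Z_def by (intro sum.neutral) auto
    qed
    with False show ?thesis by (auto simp: lp_pair_def s'_simps)
  qed
  \<comment> \<open>Dropped items carry no LP mass: \<open>Zv i j\<close> is nonnegative and bounded
    by both \<open>Xv i\<close> and \<open>Yv j\<close>.\<close>
  have pair0: "lp_pair s i j = 0" if "i \<le> dimN A" "j \<le> dimM A" "i \<notin> S \<or> j \<notin> T" for i j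
  proof -
    have "s (Xv i) = 0 \<and> i \<noteq> 0 \<or> s (Yv j) = 0 \<and> j \<noteq> 0"
      using that S T sS[of i] sT[of j] by (cases "i = 0"; cases "j = 0") auto
    moreover have "s (Xv i) = 0" if "j = 0" "i \<noteq> 0" "i \<notin> S"
      using sS[of i] \<open>i \<le> dimN A\<close> that by auto
    moreover have "s (Yv j) = 0" if "i = 0" "j \<noteq> 0" "j \<notin> T"
      using sT[of j] \<open>j \<le> dimM A\<close> that by auto
    moreover have "s (Zv i j) = 0" if "i \<noteq> 0" "j \<noteq> 0" "s (Xv i) = 0 \<or> s (Yv j) = 0"
      using s0[of i j] \<open>i \<le> dimN A\<close> \<open>j \<le> dimM A\<close> that by auto
    ultimately show ?thesis using that S T by (auto simp: lp_pair_def)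
  qed
  have norm_ST: "(\<Sum>(k, l)\<in>S \<times> T. weight A k l * lp_pair s k l) = 1"
  proof -
    have "(\<Sum>(k, l)\<in>S \<times> T. weight A k l * lp_pair s k l) = lp_norm A s"
      unfolding lp_norm_eq_sum_pairs[OF A] by (intro sum_supported [symmetric]) (simp add: pair0)
    then show ?thesis using s by (simp add: lp_feasible_def)
  qed
  have "lp_norm merged s' = (\<Sum>(i, j)\<in>index_pairs A. Z i j)"
    unfolding lp_norm_eq_sum_pairs[OF valid_merged] using pair
    by (auto simp: u_def intro!: sum.cong)
  also have "\<dots> = 1"
    unfolding Z_def sum_fibres by (rule norm_ST)
  finally have "lp_feasible merged s'"
    using constr s0(1)[OF _ items(2)] s0(2)[OF items(1)] s0(4)[OF items]
    by (auto simp: lp_feasible_def lp_vars_def ball_Un s'_simps(1-3) simp del: One_nat_def)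
  then have le: "lp_objective merged s' \<le> lp_value merged"
    by (rule lp_objective_le_value[OF valid_merged])
  have "lp_objective merged s' = (\<Sum>(i, j)\<in>index_pairs A. Z i j * (p i + q j))"
    unfolding lp_objective_eq_sum_pairs[OF valid_merged] using pair
    by (auto simp: u_def intro!: sum.cong)
  also have "\<dots> = (\<Sum>(i, j)\<in>index_pairs A. \<Sum>(k, l)\<in>fibre i j.
      weight A k l * lp_pair s k l * (p (g k) + q (h l)))"
    by (auto simp: Z_def sum_distrib_right fibre_def intro!: sum.cong)
  also have "\<dots> = (\<Sum>(k, l)\<in>S \<times> T. weight A k l * lp_pair s k l * (p (g k) + q (h l)))"
    by (rule sum_fibres)
  also have "\<dots> \<ge> (\<Sum>(k, l)\<in>S \<times> T. weight A k l * lp_pair s k l * (priceN A k + priceM A l - 2 * \<delta>))"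
  proof (intro sum_mono, clarify)
    fix k l assume "k \<in> S" "l \<in> T"
    then have "0 \<le> weight A k l * lp_pair s k l"
      using weight_nonneg[of k l] lp_pair_nonneg[OF s, of k l] S T
      by (auto simp: subset_iff)
    then show "weight A k l * lp_pair s k l * (priceN A k + priceM A l - 2 * \<delta>)
        \<le> weight A k l * lp_pair s k l * (p (g k) + q (h l))"
      using pd[OF \<open>k \<in> S\<close>] qd[OF \<open>l \<in> T\<close>] by (intro mult_left_mono) auto
  qed
  moreover have "(\<Sum>(k, l)\<in>S \<times> T. weight A k l * lp_pair s k l * (priceN A k + priceM A l - 2 * \<delta>)) =
      (\<Sum>(k, l)\<in>S \<times> T. weight A k l * lp_pair s k l * (priceN A k + priceM A l)) -
      (\<Sum>(k, l)\<in>S \<times> T. weight A k l * lp_pair s k l) * (2 * \<delta>)"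
    by (simp add: sum_distrib_right case_prod_beta sum_subtractf right_diff_distrib)
  moreover have "(\<Sum>(k, l)\<in>S \<times> T. weight A k l * lp_pair s k l * (priceN A k + priceM A l)) =
      lp_objective A s"
    unfolding lp_objective_eq_sum_pairs[OF A] by (intro sum_supported [symmetric]) (simp add: pair0)
  ultimately show ?thesis using le norm_ST by simp
qed

end

section \<open>Rounding prices\<close>

text \<open>Used once for each side of the market, with \<open>v\<close> the LP values. Here
  \<open>g\<close> chooses a representative of each class of equal LP value and equal rounded price,
  and \<open>p'\<close> rounds down to multiples of \<open>\<delta>\<close>.\<close>

lemma rounding_exists:
  fixes v p :: "nat \<Rightarrow> real"
  assumes \<delta>: "\<delta> > 0" and p0: "\<forall>i\<in>{1..n}. 0 \<le> p i"
  obtains g :: "nat \<Rightarrow> nat" and p' :: "nat \<Rightarrow> real" where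
    "g 0 = 0" "p' 0 = 0"
    "\<And>i. i \<in> {1..n} \<Longrightarrow> g i \<in> {1..n}" "\<And>i. i \<in> {1..n} \<Longrightarrow> v (g i) = v i"
    "\<And>i. i \<in> {1..n} \<Longrightarrow> 0 \<le> p' i"
    "\<And>i. i \<in> {1..n} \<Longrightarrow> p' (g i) \<le> p i" "\<And>i. i \<in> {1..n} \<Longrightarrow> p i - \<delta> \<le> p' (g i)"
    "\<And>i k. v i = v k \<Longrightarrow> \<lfloor>p i / \<delta>\<rfloor> = \<lfloor>p k / \<delta>\<rfloor> \<Longrightarrow> i \<noteq> 0 \<Longrightarrow> k \<noteq> 0 \<Longrightarrow> g i = g k"
proof -
  define key where "key i = (v i, \<lfloor>p i / \<delta>\<rfloor>)" for i
  \<comment> \<open>The least index depends on the key alone, so items with equal keys get the same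
    representative. Index 0 is kept apart.\<close>
  define g where "g i = (if i = 0 then 0 else LEAST k. k \<in> {1..n} \<and> key k = key i)" for i
  define p' where "p' i = (if i = 0 then 0 else \<delta> * real_of_int \<lfloor>p i / \<delta>\<rfloor>)" for i
  have g: "g i \<in> {1..n} \<and> key (g i) = key i" if "i \<in> {1..n}" for i
    using LeastI[of "\<lambda>k. k \<in> {1..n} \<and> key k = key i" i] that by (simp add: g_def)
  have p'g: "p' (g i) = \<delta> * real_of_int \<lfloor>p i / \<delta>\<rfloor>" if "i \<in> {1..n}" for i
    using g[OF that] by (simp add: p'_def key_def)
  have upper: "\<delta> * real_of_int \<lfloor>p i / \<delta>\<rfloor> \<le> p i" for i
    using mult_left_mono[OF of_int_floor_le[of "p i / \<delta>"], of \<delta>] \<delta> by simp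
  have lower: "p i - \<delta> \<le> \<delta> * real_of_int \<lfloor>p i / \<delta>\<rfloor>" for i
    using real_of_int_floor_add_one_ge[of "p i / \<delta>"] \<delta> by (simp add: pos_divide_le_eq algebra_simps)
  show ?thesis
  proof (rule that[of g p'])
    show "0 \<le> p' i" if "i \<in> {1..n}" for i
      using p0 that \<delta> by (simp add: p'_def)
  qed (use g p'g upper lower in \<open>auto simp: key_def g_def p'_def\<close>)
qed

text \<open>Since \<open>K * \<epsilon> = 1\<close>, the breakpoint with index \<open>I\<close> is
  \<open>(K - I) * \<epsilon>\<close>: the price intervals of the algorithm are exactly cells of the
  rounding grid of width \<open>\<epsilon> * r\<close>.\<close>

lemma floor_in_breakpoint_interval:
  assumes \<epsilon>: "\<epsilon> > 0" "real K = 1 / \<epsilon>" and r: "r > 0" and I: "I \<in> {1..K}"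
    and a: "a \<in> {breakpoint \<epsilon> I * r ..< breakpoint \<epsilon> (I - 1) * r}"
  shows "\<lfloor>a / (\<epsilon> * r)\<rfloor> = int K - int I"
proof -
  have K: "real K * \<epsilon> = 1" using \<epsilon> by simp
  have "breakpoint \<epsilon> I * r = (real K - real I) * (\<epsilon> * r)"
    unfolding breakpoint_def by (simp add: K [symmetric] algebra_simps)
  \<comment> \<open>The natural subtraction \<open>I - 1\<close> is exact because \<open>I\<close>
    is at least 1.\<close>
  moreover have "breakpoint \<epsilon> (I - 1) * r = (real K - real I + 1) * (\<epsilon> * r)"
    using I unfolding breakpoint_def by (simp add: K [symmetric] of_nat_diff algebra_simps)
  moreover have "\<epsilon> * r > 0" using \<epsilon> r by simp
  ultimately show ?thesis
    using a unfolding atLeastLessThan_iff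
    by (intro floor_unique) (simp_all only: pos_le_divide_eq pos_divide_less_eq of_int_diff of_int_of_nat_eq)
qed

text \<open>Keeps the classes disjoint from the expensive items, whose forced value 1 therefore
  cannot break constancy on a class.\<close>

lemma breakpoint_interval_below:
  assumes "\<epsilon> > 0" "r > 0" "a \<in> {breakpoint \<epsilon> I * r ..< breakpoint \<epsilon> (I - 1) * r}"
  shows "a < r"
proof -
  have "breakpoint \<epsilon> (I - 1) * r \<le> 1 * r"
    using assms by (intro mult_right_mono) (auto simp: breakpoint_def)
  then show ?thesis using assms(3) unfolding atLeastLessThan_iff by linarith
qed

text \<open>The candidate is an optimal assortment of the merged instance, pulled back and enlarged
  by the expensive items. The bound \<open>\<epsilon> < 1 / 2\<close> makes the merged LP value
  positive, so that \<open>Gap\<close> applies to it.\<close>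

lemma good_candidate_exists:
  assumes A: "valid_model A" and r: "lp_value A > 0"
    and \<epsilon>: "\<epsilon> > 0" "\<epsilon> < 1 / 2" "real K = 1 / \<epsilon>"
    and s: "lp_optimal A s" and ne: "candidates A \<epsilon> K s \<noteq> {}"
  obtains x y where "(x, y) \<in> candidates A \<epsilon> K s"
    "Gap * ((1 - 2 * \<epsilon>) * lp_value A) \<le> revenue A x y"
proof -
  define r where "r = lp_value A"
  have r0: "r > 0" using r by (simp add: r_def)
  have \<delta>: "\<epsilon> * r > 0" using \<epsilon> r0 by simp
  have feas: "lp_feasible A s" using s by (simp add: lp_optimal_def)
  note w = lp_feasible_Wv_pos[OF A feas]
  have p0: "\<forall>i\<in>itemsN A. 0 \<le> priceN A i" and q0: "\<forall>j\<in>itemsM A. 0 \<le> priceM A j"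
    using A by (simp_all add: valid_model_def)
  obtain g p where gp: "g 0 = (0::nat)" "p 0 = (0::real)"
    "\<And>i. i \<in> itemsN A \<Longrightarrow> g i \<in> itemsN A" "\<And>i. i \<in> itemsN A \<Longrightarrow> s (Xv (g i)) = s (Xv i)"
    "\<And>i. i \<in> itemsN A \<Longrightarrow> 0 \<le> p i"
    "\<And>i. i \<in> itemsN A \<Longrightarrow> p (g i) \<le> priceN A i" "\<And>i. i \<in> itemsN A \<Longrightarrow> priceN A i - \<epsilon> * r \<le> p (g i)"
    "\<And>i k. s (Xv i) = s (Xv k) \<Longrightarrow> \<lfloor>priceN A i / (\<epsilon> * r)\<rfloor> = \<lfloor>priceN A k / (\<epsilon> * r)\<rfloor> \<Longrightarrow>
      i \<noteq> 0 \<Longrightarrow> k \<noteq> 0 \<Longrightarrow> g i = g k"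
    apply (rule rounding_exists[OF \<delta> p0, where v = "\<lambda>i. s (Xv i)"])
    subgoal for f c by (rule that[of f c])
    done
  obtain h q where hq: "h 0 = (0::nat)" "q 0 = (0::real)"
    "\<And>j. j \<in> itemsM A \<Longrightarrow> h j \<in> itemsM A" "\<And>j. j \<in> itemsM A \<Longrightarrow> s (Yv (h j)) = s (Yv j)"
    "\<And>j. j \<in> itemsM A \<Longrightarrow> 0 \<le> q j"
    "\<And>j. j \<in> itemsM A \<Longrightarrow> q (h j) \<le> priceM A j" "\<And>j. j \<in> itemsM A \<Longrightarrow> priceM A j - \<epsilon> * r \<le> q (h j)"
    "\<And>j l. s (Yv j) = s (Yv l) \<Longrightarrow> \<lfloor>priceM A j / (\<epsilon> * r)\<rfloor> = \<lfloor>priceM A l / (\<epsilon> * r)\<rfloor> \<Longrightarrow>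
      j \<noteq> 0 \<Longrightarrow> l \<noteq> 0 \<Longrightarrow> h j = h l"
    apply (rule rounding_exists[OF \<delta> q0, where v = "\<lambda>j. s (Yv j)"])
    subgoal for f c by (rule that[of f c])
    done
  define S where "S = insert 0 {i \<in> itemsN A. s (Xv i) \<noteq> 0}"
  define T where "T = insert 0 {j \<in> itemsM A. s (Yv j) \<noteq> 0}"
  have price0: "priceN A 0 = 0" "priceM A 0 = 0" using A by (auto simp: valid_model_def)
  interpret merging A S T g h p q
  proof
    show "g i \<le> dimN A" "g i = 0 \<longleftrightarrow> i = 0" "p (g i) \<le> priceN A i" if "i \<in> S" for i
      using that gp(1,2,6) gp(3)[of i] price0 by (auto simp: S_def)
    show "h j \<le> dimM A" "h j = 0 \<longleftrightarrow> j = 0" "q (h j) \<le> priceM A j" if "j \<in> T" for j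
      using that hq(1,2,6) hq(3)[of j] price0 by (auto simp: T_def)
  qed (use A gp(2,5) hq(2,5) in \<open>simp_all add: S_def T_def subset_iff\<close>)
  have "lp_objective A s - 2 * (\<epsilon> * r) \<le> lp_value merged"
  proof (rule lp_value_merged_ge[OF feas])
    show "priceN A i - \<epsilon> * r \<le> p (g i)" if "i \<in> S" for i
      using that gp(1,2) gp(7)[of i] price0 \<delta> by (cases "i = 0") (auto simp: S_def)
    show "priceM A j - \<epsilon> * r \<le> q (h j)" if "j \<in> T" for j
      using that hq(1,2) hq(7)[of j] price0 \<delta> by (cases "j = 0") (auto simp: T_def)
  qed (use gp(4) hq(4) in \<open>auto simp: S_def T_def\<close>)
  then have B: "(1 - 2 * \<epsilon>) * r \<le> lp_value merged"
    using lp_value_eq[OF s] by (simp add: r_def algebra_simps)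
  moreover have "(1 - 2 * \<epsilon>) * r > 0" using \<epsilon> r0 by simp
  ultimately have B0: "lp_value merged > 0" by simp
  obtain x0 y0 where xy0: "(x0, y0) \<in> assortments merged" "opt_revenue merged = revenue merged x0 y0"
    by (rule opt_revenue_attained)
  define x where "x = (\<lambda>i. if i \<in> highN A then 1 else pullN x0 i)"
  define y where "y = (\<lambda>j. if j \<in> highM A then 1 else pullM y0 j)"
  note pull = pull_assortment[OF xy0(1)]
  have xy: "(x, y) \<in> assortments A"
    using pull by (auto simp: assortments_def binary_def x_def y_def highN_def highM_def)
  \<comment> \<open>Nonemptiness excludes an expensive item with LP value 0, for which being forced
    in and being forced out would clash.\<close>
  have high: "\<forall>i\<in>highN A. s (Xv i) \<noteq> 0" "\<forall>j\<in>highM A. s (Yv j) \<noteq> 0"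
    using ne by (auto simp: candidates_nonempty_iff)
  \<comment> \<open>Equal ratios mean equal LP values as \<open>s Wv\<close> is positive; with equal
    rounded prices the two items share a representative, whatever \<open>t\<close> is.\<close>
  have X: "x i = x k" if "I \<in> {1..K}" "i \<in> classN A \<epsilon> s t I" "k \<in> classN A \<epsilon> s t I" for i k t I
  proof -
    have "s (Xv i) / s Wv = s (Xv k) / s Wv" using that by (simp add: classN_def)
    then have v: "s (Xv i) = s (Xv k)" using w by simp
    have "\<lfloor>priceN A i / (\<epsilon> * r)\<rfloor> = \<lfloor>priceN A k / (\<epsilon> * r)\<rfloor>"
      using that floor_in_breakpoint_interval[OF \<epsilon>(1,3) r0 that(1)]
      by (simp add: classN_def r_def)
    then have "g i = g k" using gp(8)[OF v] that by (auto simp: classN_def)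
    moreover have "i \<notin> highN A" "k \<notin> highN A"
      using that breakpoint_interval_below[OF \<epsilon>(1) r0, of _ I]
      by (auto simp: classN_def highN_def r_def not_le)
    moreover have "i \<in> S \<longleftrightarrow> k \<in> S" using that v by (auto simp: S_def classN_def)
    ultimately show ?thesis by (simp add: x_def pullN_def)
  qed
  have Y: "y j = y l" if "J \<in> {1..K}" "j \<in> classM A \<epsilon> s t J" "l \<in> classM A \<epsilon> s t J" for j l t J
  proof -
    have "s (Yv j) / s Wv = s (Yv l) / s Wv" using that by (simp add: classM_def)
    then have v: "s (Yv j) = s (Yv l)" using w by simp
    have "\<lfloor>priceM A j / (\<epsilon> * r)\<rfloor> = \<lfloor>priceM A l / (\<epsilon> * r)\<rfloor>"
      using that floor_in_breakpoint_interval[OF \<epsilon>(1,3) r0 that(1)]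
      by (simp add: classM_def r_def)
    then have "h j = h l" using hq(8)[OF v] that by (auto simp: classM_def)
    moreover have "j \<notin> highM A" "l \<notin> highM A"
      using that breakpoint_interval_below[OF \<epsilon>(1) r0, of _ J]
      by (auto simp: classM_def highM_def r_def not_le)
    moreover have "j \<in> T \<longleftrightarrow> l \<in> T" using that v by (auto simp: T_def classM_def)
    ultimately show ?thesis by (simp add: y_def pullM_def)
  qed
  have "\<forall>i\<in>highN A. x i = 1" "\<forall>j\<in>highM A. y j = 1"
    by (simp_all add: x_def y_def)
  moreover have "\<forall>i\<in>itemsN A. s (Xv i) = 0 \<longrightarrow> x i = 0" "\<forall>j\<in>itemsM A. s (Yv j) = 0 \<longrightarrow> y j = 0"
    using high unfolding x_def y_def pullN_def pullM_def by (auto simp: S_def T_def)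
  ultimately have "(x, y) \<in> candidates A \<epsilon> K s"
    using xy X Y unfolding candidates_def by blast
  moreover have "Gap * ((1 - 2 * \<epsilon>) * r) \<le> revenue A x y"
  proof -
    have "Gap * ((1 - 2 * \<epsilon>) * r) \<le> Gap * lp_value merged"
      using B Gap_nonneg[OF A r] by (rule mult_left_mono)
    also have "\<dots> \<le> opt_revenue merged"
      using Gap_le[OF valid_merged B0] B0 by (simp add: pos_le_divide_eq)
    also have "\<dots> \<le> revenue A (pullN x0) (pullM y0)"
      unfolding xy0(2) by (rule revenue_merged_le[OF xy0(1)])
    \<comment> \<open>The pulled-back revenue is at most the LP value, so adding items priced at
      least that value cannot lower it.\<close>
    also have "\<dots> \<le> revenue A x y"
      by (rule revenue_add_expensive_items[OF A pull xy revenue_le_lp_value[OF A pull]])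
        (auto simp: x_def y_def highN_def highM_def)
    finally show ?thesis .
  qed
  ultimately show ?thesis using that by (simp add: r_def)
qed

section \<open>The approximation guarantee\<close>

theorem theorem6:
  fixes A :: model and \<epsilon> :: real and K :: nat and x y :: "nat \<Rightarrow> real"
  assumes "valid_model A"
    and "\<epsilon> > 0" and "K > 0" and "real K = 1 / \<epsilon>"
    and "algorithm_output A \<epsilon> K x y"
  shows "revenue A x y \<ge> (Gap - 4 * \<epsilon>) * opt_revenue A"
proof -
  note A = assms(1)
  obtain s where s: "lp_optimal A s" "(x, y) \<in> candidates A \<epsilon> K s"
    and best: "\<And>x' y'. (x', y') \<in> candidates A \<epsilon> K s \<Longrightarrow> revenue A x' y' \<le> revenue A x y"
    using assms(5) unfolding algorithm_output_def by blast
  have "(x, y) \<in> assortments A" using s(2) by (auto simp: candidates_def)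
  then have rev0: "0 \<le> revenue A x y" by (rule revenue_nonneg[OF A])
  note opt0 = opt_revenue_nonneg[OF A] and opt_le = opt_revenue_le_lp_value[OF A]
  show ?thesis
  proof (cases "lp_value A > 0")
    \<comment> \<open>The optimal revenue lies between 0 and a nonpositive LP value.\<close>
    case False
    then have "opt_revenue A = 0" using opt0 opt_le by simp
    then show ?thesis using rev0 by simp
  next
    case r: True
    have Gap1: "Gap \<le> 1"
    proof -
      have "Gap \<le> opt_revenue A / lp_value A" by (rule Gap_le[OF A r])
      also have "\<dots> \<le> 1" using r opt_le by simp
      finally show ?thesis .
    qed
    show ?thesis
    proof (cases "\<epsilon> < 1 / 2 \<and> Gap \<ge> 4 * \<epsilon>")
      case False
      \<comment> \<open>If \<open>\<epsilon>\<close> is at least 1/2, then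
        \<open>4 * \<epsilon>\<close> is at least 2 and exceeds \<open>Gap\<close>; the claimed
        bound is then nonpositive.\<close>
      then have "Gap - 4 * \<epsilon> \<le> 0" using Gap1 by auto
      then have "(Gap - 4 * \<epsilon>) * opt_revenue A \<le> 0" using opt0 by (rule mult_nonpos_nonneg)
      then show ?thesis using rev0 by simp
    next
      case True
      obtain x' y' where xy': "(x', y') \<in> candidates A \<epsilon> K s"
        "Gap * ((1 - 2 * \<epsilon>) * lp_value A) \<le> revenue A x' y'"
        using good_candidate_exists[OF A r assms(2) _ assms(4) s(1)] s(2) True by blast
      have "(Gap - 4 * \<epsilon>) * opt_revenue A \<le> (Gap - 4 * \<epsilon>) * lp_value A"
        using True opt_le by (intro mult_left_mono) auto
      also have "\<dots> \<le> (Gap * (1 - 2 * \<epsilon>)) * lp_value A"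
      proof (intro mult_right_mono)
        \<comment> \<open>As \<open>Gap\<close> is at most 1, the relative loss
          \<open>2 * \<epsilon> * Gap\<close> becomes an absolute loss of at most
          \<open>2 * \<epsilon>\<close>.\<close>
        have "\<epsilon> * Gap \<le> \<epsilon> * 1" using Gap1 assms(2) by (intro mult_left_mono) auto
        moreover have "Gap * (1 - 2 * \<epsilon>) = Gap - 2 * (\<epsilon> * Gap)" by (simp add: algebra_simps)
        ultimately show "Gap - 4 * \<epsilon> \<le> Gap * (1 - 2 * \<epsilon>)" using assms(2) by linarith
      qed (use r in simp)
      also have "\<dots> \<le> revenue A x' y'" using xy'(2) by (simp add: mult.assoc)
      also have "\<dots> \<le> revenue A x y" by (rule best[OF xy'(1)])
      finally show ?thesis .
    qed
  qed
qed

end
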